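(* Given a contextual scenario $H$ and a probabilistic model $p$ on $H$, the number $\alpha^*_{NO(H)}(p)$ provides a lower bound on the maximum violation of all positive Bell-type inequalities of the probabilistic model, namely, $$\alpha^*_{NO(H)}(p)\;\le\;\max_{w\ge 0}\frac{\langle p,w\rangle}{L(H,w)}.$$
   Context: A hypergraph, or contextual scenario, is a pair $H=(V(H),E(H))$ where $V(H)$ is a finite set (the vertices) and $E(H)$ is a set of non-empty subsets of $V(H)$ (the hyperedges). The non-orthogonality graph $NO(H)$ is the graph with vertex set $V(H)$ in which distinct $u,v$ are adjacent iff there is no hyperedge $e$ with $u\in e$ and $v\in e$. A probabilistic model on $H$ is a function $p:V(H)\to[0,+\infty)$ with $\sum_{v\in e}p(v)=1$ for all $e\in E(H)$; $\mathcal{G}(H)$ is the set of all probabilistic models on $H$. A model $p\in\mathcal{G}(H)$ is deterministic if $p(v)\in\{0,1\}$ for every $v\in V(H)$, and classical if it is a convex combination of deterministic probabilistic models; $C(H)$ is the set of all classical models. Any nontrivial inequality for the contextual scenario $H$ is represented by a real weight function $w:V(H)\to\mathbb{R}$ with at least one non-negative component. Write $\langle p,w\rangle=\sum_{v\in V(H)}p(v)w(v)$. An inequality $\langle p,w\rangle\le L(H,w)$ is called a generalized Bell inequality if it is satisfied by all classical models $p_{cl}\in C(H)$; here one takes $L(H,w)=\max_{p_{cl}\in C(H)}\langle p_{cl},w\rangle$. The violation of the generalized Bell inequality $w$ by the probabilistic model $p$ is quantified by $\langle p,w\rangle/L(H,w)$. In the claim the maximum is over weight functions $w\ge 0$, i.e.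 $w:V(H)\to[0,+\infty)$ (the positive Bell-type inequalities). For a graph $G$ and a weight $p:V(G)\to[0,+\infty)$, the weighted fractional packing number is $\alpha^*_G(p)=\max_q\sum_{v\in V(G)}p(v)q(v)$, where $q:V(G)\to[0,1]$ ranges over all vertex weightings satisfying $\sum_{v\in C}q(v)\le 1$ for all cliques $C$ of $G$; a clique is a subset of $V(G)$ any two distinct members of which are adjacent. *)

theory Defs
  imports "HOL-Analysis.Analysis"
begin

record 'v hypergraph =
  hverts :: "'v set"
  hedges :: "'v set set"

record 'v graph =
  gverts :: "'v set"
  gadj :: "'v \<Rightarrow> 'v \<Rightarrow> bool"

definition contextual_scenario :: "'v hypergraph \<Rightarrow> bool" where
  "contextual_scenario H \<longleftrightarrow>
     finite (hverts H) \<and> (\<forall>e\<in>hedges H. e \<noteq> {} \<and> e \<subseteq> hverts H)"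

definition non_orth_graph :: "'v hypergraph \<Rightarrow> 'v graph" where
  "non_orth_graph H =
     \<lparr>gverts = hverts H,
      gadj = (\<lambda>u v. u \<in> hverts H \<and> v \<in> hverts H \<and> u \<noteq> v \<and>
                    \<not> (\<exists>e\<in>hedges H. u \<in> e \<and> v \<in> e))\<rparr>"

(* Functions on V(H) are total functions; only their values on the vertex set
   matter, and no condition is imposed elsewhere. *)

definition prob_models :: "'v hypergraph \<Rightarrow> ('v \<Rightarrow> real) set" where
  "prob_models H =
     {p. (\<forall>v\<in>hverts H. 0 \<le> p v) \<and> (\<forall>e\<in>hedges H. (\<Sum>v\<in>e. p v) = 1)}"

definition det_models :: "'v hypergraph \<Rightarrow> ('v \<Rightarrow> real) set" where
  "det_models H = {p \<in> prob_models H. \<forall>v\<in>hverts H. p v \<in> {0, 1}}"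

definition classical_models :: "'v hypergraph \<Rightarrow> ('v \<Rightarrow> real) set" where
  "classical_models H =
     {p. \<exists>D c. finite D \<and> D \<subseteq> det_models H \<and> (\<forall>d\<in>D. 0 \<le> c d) \<and> (\<Sum>d\<in>D. c d) = 1 \<and>
               (\<forall>v\<in>hverts H. p v = (\<Sum>d\<in>D. c d * d v))}"

definition pairing :: "'v hypergraph \<Rightarrow> ('v \<Rightarrow> real) \<Rightarrow> ('v \<Rightarrow> real) \<Rightarrow> real" where
  "pairing H p w = (\<Sum>v\<in>hverts H. p v * w v)"

definition nonneg_weights :: "'v hypergraph \<Rightarrow> ('v \<Rightarrow> real) set" where
  "nonneg_weights H = {w. \<forall>v\<in>hverts H. 0 \<le> w v}"

(* L(H,w), for nonnegative w only: ennreal would truncate negative pairings.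
   If there are classical models, the supremum is the maximum over the finitely many
   restrictions of deterministic models to V(H).  If there are none, the maximum in the
   usual definition does not exist, and L(H,w) is 0 here. *)
definition classical_bound :: "'v hypergraph \<Rightarrow> ('v \<Rightarrow> real) \<Rightarrow> ennreal" where
  "classical_bound H w = (SUP q\<in>classical_models H. ennreal (pairing H q w))"

(* L(H,w) can be 0; in ennreal, x / 0 = \<infinity> for x > 0 (no classical model reaches any
   fraction of the value x), and 0 / 0 = 0. *)
definition violation :: "'v hypergraph \<Rightarrow> ('v \<Rightarrow> real) \<Rightarrow> ('v \<Rightarrow> real) \<Rightarrow> ennreal" where
  "violation H p w = ennreal (pairing H p w) / classical_bound H w"

(* GREATEST is a genuine maximum: it is unspecified if the maximum is not attained. *)
definition max_violation :: "'v hypergraph \<Rightarrow> ('v \<Rightarrow> real) \<Rightarrow> ennreal" where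
  "max_violation H p = (GREATEST x. \<exists>w\<in>nonneg_weights H. x = violation H p w)"

definition clique :: "'v graph \<Rightarrow> 'v set \<Rightarrow> bool" where
  "clique G C \<longleftrightarrow> C \<subseteq> gverts G \<and> (\<forall>u\<in>C. \<forall>v\<in>C. u \<noteq> v \<longrightarrow> gadj G u v)"

definition fractional_packings :: "'v graph \<Rightarrow> ('v \<Rightarrow> real) set" where
  "fractional_packings G =
     {q. (\<forall>v\<in>gverts G. 0 \<le> q v \<and> q v \<le> 1) \<and> (\<forall>C. clique G C \<longrightarrow> (\<Sum>v\<in>C. q v) \<le> 1)}"

definition fractional_packing_number :: "'v graph \<Rightarrow> ('v \<Rightarrow> real) \<Rightarrow> real" where
  "fractional_packing_number G p =
     (GREATEST x. \<exists>q\<in>fractional_packings G. x = (\<Sum>v\<in>gverts G. p v * q v))"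

end

theory Submission
  imports Defs
begin

text \<open>
  The support of a deterministic model meets every hyperedge in exactly one vertex, so no two of
  its vertices share a hyperedge: it is a clique of the non-orthogonality graph.  The constraints
  on a fractional packing \<open>q\<close> therefore include \<open>\<langle>d, q\<rangle> \<le> 1\<close> for every deterministic model
  \<open>d\<close>, hence, by convexity, for every classical model.  Read as a weight, \<open>q\<close> has classical bound
  at most \<open>1\<close>, and its violation by \<open>p\<close> is at least \<open>\<langle>p, q\<rangle>\<close>.  Taking \<open>q\<close> optimal gives the
  inequality; it can be strict because a clique need not lie in the support of a deterministic
  model.

  Both sides are maxima, so each must be shown to be attained.  Unless a weight has infinite
  violation, both are maxima of a linear functional over a part of the cube \<open>[0,1]\<^sup>V\<close> cut out by inequalities
  \<open>\<langle>a, q\<rangle> \<le> 1\<close> (\<open>unit_polytope\<close>), which is compact: \<open>a\<close> ranges over the indicator functions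
  of the cliques for the packing number, and over the deterministic models for the violation.
  The violation is invariant under scaling the weight, so weights may be normalised to classical
  bound \<open>1\<close>, which puts them into the second polytope.  The normalisation fails only for
  weights with classical bound \<open>0\<close>, and the boundedness only at vertices that no deterministic
  model uses; both lead to an infinite violation, attained by a single weight, as soon as
  \<open>p\<close> is positive there.
\<close>

section \<open>Linear functionals on polytopes in the unit cube\<close>

definition unit_polytope :: "'v set \<Rightarrow> ('v \<Rightarrow> real) set \<Rightarrow> ('v \<Rightarrow> real) set" where
  "unit_polytope V A =
     {q. (\<forall>v\<in>V. 0 \<le> q v \<and> q v \<le> 1) \<and> (\<forall>a\<in>A. (\<Sum>v\<in>V. a v * q v) \<le> 1)}"

text \<open>
  Compactness: by Tychonoff's theorem the functions with values in \<open>[0,1]\<close> on \<open>V\<close> and value \<open>0\<close>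
  elsewhere form a compact set.  Points of the polytope are arbitrary outside \<open>V\<close>, so the
  polytope itself is not compact, but setting their values outside \<open>V\<close> to \<open>0\<close> changes no sum
  over \<open>V\<close>.
\<close>

lemma linear_functional_attains_max_on_unit_polytope:
  fixes p :: "'v \<Rightarrow> real"
  obtains q where "q \<in> unit_polytope V A"
    and "\<And>r. r \<in> unit_polytope V A \<Longrightarrow> (\<Sum>v\<in>V. p v * r v) \<le> (\<Sum>v\<in>V. p v * q v)"
proof -
  define B :: "('v \<Rightarrow> real) set" where
    "B = PiE UNIV (\<lambda>v. if v \<in> V then {0..1} else {0})"
  have "compactin (product_topology (\<lambda>v::'v. euclidean) UNIV) B"
    unfolding B_def by (subst compactin_PiE) auto
  then have "compact B"
    by (simp add: euclidean_product_topology)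
  define K where "K = B \<inter> (\<Inter>a\<in>A. {q. (\<Sum>v\<in>V. a v * q v) \<le> 1})"
  have "closed (\<Inter>a\<in>A. {q::'v \<Rightarrow> real. (\<Sum>v\<in>V. a v * q v) \<le> 1})"
    by (intro closed_INT ballI closed_Collect_le continuous_intros continuous_on_product_coordinates)
  with \<open>compact B\<close> have "compact K"
    unfolding K_def by (rule compact_Int_closed)
  moreover have "(\<lambda>_. 0) \<in> K"
    unfolding K_def B_def by (auto simp: PiE_iff)
  then have "K \<noteq> {}" by blast
  moreover have "continuous_on K (\<lambda>q. \<Sum>v\<in>V. p v * q v)"
    by (rule continuous_on_subset[where s = UNIV])
      (intro continuous_intros continuous_on_product_coordinates subset_UNIV)+
  ultimately obtain q where q: "q \<in> K"
    and max: "\<And>r. r \<in> K \<Longrightarrow> (\<Sum>v\<in>V. p v * r v) \<le> (\<Sum>v\<in>V. p v * q v)"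
    using continuous_attains_sup[of K "\<lambda>q. \<Sum>v\<in>V. p v * q v"] by blast
  show thesis
  proof
    show "q \<in> unit_polytope V A"
      using q unfolding K_def B_def unit_polytope_def
      by (auto simp: PiE_iff split: if_splits)
  next
    fix r assume r: "r \<in> unit_polytope V A"
    define r' where "r' = (\<lambda>v. if v \<in> V then r v else 0)"
    have same_sum: "(\<Sum>v\<in>V. a v * r' v) = (\<Sum>v\<in>V. a v * r v)" for a :: "'v \<Rightarrow> real"
      by (rule sum.cong) (simp_all add: r'_def)
    have "r' \<in> K"
      using r unfolding K_def B_def unit_polytope_def
      by (auto simp: PiE_iff same_sum) (auto simp: r'_def)
    from max[OF this] show "(\<Sum>v\<in>V. p v * r v) \<le> (\<Sum>v\<in>V. p v * q v)"
      by (simp add: same_sum)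
  qed
qed

section \<open>Fractional packings\<close>

lemma fractional_packings_eq_unit_polytope:
  assumes "finite (gverts G)"
  shows "fractional_packings G = unit_polytope (gverts G) (indicator ` Collect (clique G))"
proof -
  have "(\<Sum>v\<in>gverts G. indicator C v * q v) = (\<Sum>v\<in>C. q v)"
    if "clique G C" for C and q :: "'a \<Rightarrow> real"
  proof -
    have "C \<subseteq> gverts G" using that by (simp add: clique_def)
    then show ?thesis
      using sum.inter_restrict[OF assms, of q C]
      by (simp add: indicator_def of_bool_def Int_absorb1 if_distrib[of "\<lambda>x. x * _"] cong: if_cong)
  qed
  then show ?thesis
    unfolding fractional_packings_def unit_polytope_def by auto
qed

lemma fractional_packing_number_attained:
  assumes "finite (gverts G)"
  obtains q where "q \<in> fractional_packings G"
    and "fractional_packing_number G p = (\<Sum>v\<in>gverts G. p v * q v)"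
proof -
  obtain q where q: "q \<in> fractional_packings G"
    and max: "\<And>r. r \<in> fractional_packings G \<Longrightarrow>
      (\<Sum>v\<in>gverts G. p v * r v) \<le> (\<Sum>v\<in>gverts G. p v * q v)"
    unfolding fractional_packings_eq_unit_polytope[OF assms]
    using linear_functional_attains_max_on_unit_polytope by blast
  have "fractional_packing_number G p = (\<Sum>v\<in>gverts G. p v * q v)"
    unfolding fractional_packing_number_def
    by (rule Greatest_equality) (use q max in auto)
  with q that show thesis by blast
qed

section \<open>The classical bound\<close>

lemma det_models_subset_classical_models: "det_models H \<subseteq> classical_models H"
proof
  fix d assume "d \<in> det_models H"
  then show "d \<in> classical_models H"
    unfolding classical_models_def
    by (intro CollectI exI[of _ "{d}"] exI[of _ "\<lambda>_. 1"]) auto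
qed

lemma pairing_det_model_le_classical_bound:
  "d \<in> det_models H \<Longrightarrow> ennreal (pairing H d w) \<le> classical_bound H w"
  unfolding classical_bound_def
  using det_models_subset_classical_models by (intro SUP_upper) blast

text \<open>
  A linear functional on a convex hull is bounded by any common bound on the generating points.
\<close>

lemma classical_bound_leI:
  assumes bound: "\<And>d. d \<in> det_models H \<Longrightarrow> pairing H d w \<le> b"
  shows "classical_bound H w \<le> ennreal b"
  unfolding classical_bound_def
proof (rule SUP_least)
  fix q assume "q \<in> classical_models H"
  then obtain D c where D: "finite D" "D \<subseteq> det_models H"
    and c: "\<forall>d\<in>D. 0 \<le> c d" "(\<Sum>d\<in>D. c d) = 1"
    and q: "\<forall>v\<in>hverts H. q v = (\<Sum>d\<in>D. c d * d v)"
    unfolding classical_models_def by blast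
  have "pairing H q w = (\<Sum>v\<in>hverts H. \<Sum>d\<in>D. c d * (d v * w v))"
    unfolding pairing_def
    by (rule sum.cong) (simp_all add: q sum_distrib_right mult.assoc)
  also have "\<dots> = (\<Sum>d\<in>D. c d * pairing H d w)"
    unfolding pairing_def by (subst sum.swap) (simp add: sum_distrib_left)
  also have "\<dots> \<le> (\<Sum>d\<in>D. c d * b)"
    using D c bound by (intro sum_mono mult_left_mono) auto
  also have "\<dots> = b"
    by (simp add: sum_distrib_right[symmetric] c)
  finally show "ennreal (pairing H q w) \<le> ennreal b"
    by (rule ennreal_leI)
qed

lemma pairing_nonneg:
  assumes "p \<in> prob_models H" "w \<in> nonneg_weights H"
  shows "0 \<le> pairing H p w"
  using assms unfolding pairing_def prob_models_def nonneg_weights_def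
  by (auto intro!: sum_nonneg)

lemma pairing_le_violation:
  assumes "classical_bound H w \<le> 1"
  shows "ennreal (pairing H p w) \<le> violation H p w"
proof (cases "classical_bound H w")
  case (real l)
  show ?thesis
  proof (cases "0 < l \<and> 0 \<le> pairing H p w")
    case True
    moreover have "l \<le> 1" using assms real by simp
    ultimately have "pairing H p w \<le> pairing H p w / l"
      by (simp add: pos_le_divide_eq mult_left_le)
    with True show ?thesis
      unfolding violation_def real by (simp add: divide_ennreal)
  next
    case False
    with real show ?thesis
      unfolding violation_def by (auto simp: ennreal_neg)
  qed
qed (use assms in \<open>simp add: top_unique\<close>)

section \<open>The maximal violation is attained\<close>

text \<open>
  When no single weight has infinite violation, a maximiser of \<open>\<langle>p, w\<rangle>\<close> over the polytope of
  the deterministic models works: its violation is at least \<open>\<langle>p, w\<rangle>\<close>, and the violation of any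
  other weight \<open>u\<close> is the value of \<open>p\<close> on a point of the polytope obtained by rescaling \<open>u\<close>.
\<close>

lemma max_violation_attained:
  assumes H: "contextual_scenario H" and p: "p \<in> prob_models H"
  obtains w where "w \<in> nonneg_weights H"
    and "\<And>u. u \<in> nonneg_weights H \<Longrightarrow> violation H p u \<le> violation H p w"
proof (cases "\<exists>w\<in>nonneg_weights H. violation H p w = top")
  case True
  then show thesis using that by (metis top_greatest)
next
  case finite_violations: False
  have fin: "finite (hverts H)"
    using H by (simp add: contextual_scenario_def)
  have pairing_zero: "pairing H p w = 0"
    if "w \<in> nonneg_weights H" "classical_bound H w = 0" for w
    using finite_violations that pairing_nonneg[OF p that(1)]
    by (auto simp: violation_def split: if_splits)
  \<comment> \<open>The indicator weight of a vertex at which all deterministic models vanish has classical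
      bound \<open>0\<close>.\<close>
  have p_zero: "p v = 0" if v: "v \<in> hverts H" "\<forall>d\<in>det_models H. d v = 0" for v
  proof -
    have pair: "pairing H r (indicator {v}) = r v" for r
      using sum.delta[OF fin, of v r] v(1)
      by (simp add: pairing_def indicator_def of_bool_def if_distrib[of "\<lambda>x. _ * x"] cong: if_cong)
    have "classical_bound H (indicator {v}) \<le> ennreal 0"
      by (rule classical_bound_leI) (simp add: pair v)
    then show ?thesis
      using pairing_zero[of "indicator {v}"] by (simp add: pair nonneg_weights_def)
  qed
  obtain w where w: "w \<in> unit_polytope (hverts H) (det_models H)"
    and max: "\<And>r. r \<in> unit_polytope (hverts H) (det_models H) \<Longrightarrow> pairing H p r \<le> pairing H p w"
    using linear_functional_attains_max_on_unit_polytope[of "hverts H" "det_models H" p]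
    unfolding pairing_def by blast
  have w_nonneg: "w \<in> nonneg_weights H"
    using w by (simp add: unit_polytope_def nonneg_weights_def)
  have "classical_bound H w \<le> 1"
    using classical_bound_leI[of H w 1] w by (simp add: unit_polytope_def pairing_def)
  then have w_le: "ennreal (pairing H p w) \<le> violation H p w"
    by (rule pairing_le_violation)
  have "violation H p u \<le> violation H p w" if u: "u \<in> nonneg_weights H" for u
  proof (cases "classical_bound H u")
    case top
    then show ?thesis by (simp add: violation_def)
  next
    case (real l)
    show ?thesis
    proof (cases "l = 0")
      case True
      then show ?thesis
        using pairing_zero[OF u] real by (simp add: violation_def)
    next
      case False
      with real have "l > 0" by simp
      \<comment> \<open>The classical bound does not limit \<open>u\<close> at vertices where all deterministic models
          vanish; there \<open>p\<close> vanishes too, so the weight may be set to \<open>0\<close>.\<close>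
      define r where "r = (\<lambda>v. if \<exists>d\<in>det_models H. d v \<noteq> 0 then u v / l else 0)"
      have u_le: "pairing H d u \<le> l" if "d \<in> det_models H" for d
        using pairing_det_model_le_classical_bound[OF that, of u] real by simp
      have r_nonneg: "0 \<le> r v" if "v \<in> hverts H" for v
        using u that \<open>l > 0\<close> by (simp add: r_def nonneg_weights_def)
      have r_pair: "pairing H d r \<le> 1" if d: "d \<in> det_models H" for d
      proof -
        have "pairing H d r = pairing H d u / l"
          unfolding pairing_def sum_divide_distrib
          by (rule sum.cong) (use d in \<open>auto simp: r_def\<close>)
        with u_le[OF d] \<open>l > 0\<close> show ?thesis by simp
      qed
      have r_le: "r v \<le> 1" if v: "v \<in> hverts H" for v
      proof (cases "\<exists>d\<in>det_models H. d v \<noteq> 0")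
        case True
        then obtain d where d: "d \<in> det_models H" "d v \<noteq> 0" by blast
        then have "d v = 1" and d_nonneg: "\<forall>x\<in>hverts H. 0 \<le> d x"
          using v by (auto simp: det_models_def prob_models_def)
        then have "r v = d v * r v" by simp
        also have "\<dots> \<le> pairing H d r"
          unfolding pairing_def
          by (rule member_le_sum[OF v _ fin]) (use d_nonneg r_nonneg in auto)
        also have "\<dots> \<le> 1" by (rule r_pair[OF d(1)])
        finally show ?thesis .
      qed (auto simp: r_def)
      have "r \<in> unit_polytope (hverts H) (det_models H)"
        using r_nonneg r_le r_pair by (auto simp: unit_polytope_def pairing_def)
      then have "pairing H p r \<le> pairing H p w" by (rule max)
      moreover have "pairing H p r = pairing H p u / l"
        unfolding pairing_def sum_divide_distrib
        by (rule sum.cong) (use p_zero in \<open>auto simp: r_def\<close>)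
      ultimately have "violation H p u \<le> ennreal (pairing H p w)"
        using \<open>l > 0\<close> pairing_nonneg[OF p u]
        by (simp add: violation_def real divide_ennreal ennreal_leI)
      with w_le show ?thesis by (rule order_trans[rotated])
    qed
  qed
  with w_nonneg show thesis by (rule that)
qed

lemma violation_le_max_violation:
  assumes "contextual_scenario H" "p \<in> prob_models H" "u \<in> nonneg_weights H"
  shows "violation H p u \<le> max_violation H p"
proof -
  obtain w where w: "w \<in> nonneg_weights H"
    and max: "\<And>u. u \<in> nonneg_weights H \<Longrightarrow> violation H p u \<le> violation H p w"
    using max_violation_attained[OF assms(1,2)] by blast
  have "max_violation H p = violation H p w"
    unfolding max_violation_def by (rule Greatest_equality) (use w max in auto)
  with max[OF assms(3)] show ?thesis by simp
qed

section \<open>Packings as weights\<close>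

text \<open>
  Two vertices of value \<open>1\<close> in a common hyperedge would already sum to \<open>2\<close> there.
\<close>

lemma det_model_support_is_clique:
  assumes H: "contextual_scenario H" and d: "d \<in> det_models H"
  shows "clique (non_orth_graph H) {v \<in> hverts H. d v = 1}"
proof -
  have False if e: "e \<in> hedges H" "u \<in> e" "v \<in> e" and "u \<noteq> v" "d u = 1" "d v = 1" for e u v
  proof -
    have e_sub: "e \<subseteq> hverts H" and fin: "finite e"
      using H e(1) by (auto simp: contextual_scenario_def intro: finite_subset)
    have "2 = sum d {u, v}" using that by simp
    also have "\<dots> \<le> sum d e"
      by (rule sum_mono2[OF fin])
        (use e e_sub d in \<open>auto simp: det_models_def prob_models_def\<close>)
    also have "\<dots> = 1"
      using d e(1) by (simp add: det_models_def prob_models_def)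
    finally show False by simp
  qed
  then show ?thesis
    unfolding clique_def non_orth_graph_def by auto
qed

lemma classical_bound_fractional_packing_le_1:
  assumes H: "contextual_scenario H" and q: "q \<in> fractional_packings (non_orth_graph H)"
  shows "classical_bound H q \<le> 1"
proof -
  have "pairing H d q \<le> 1" if d: "d \<in> det_models H" for d
  proof -
    let ?C = "{v \<in> hverts H. d v = 1}"
    have fin: "finite (hverts H)"
      using H by (simp add: contextual_scenario_def)
    have "pairing H d q = (\<Sum>v\<in>hverts H. if d v = 1 then q v else 0)"
      unfolding pairing_def
      by (rule sum.cong) (use d in \<open>auto simp: det_models_def\<close>)
    also have "\<dots> = sum q ?C"
      by (rule sum.inter_filter[OF fin, symmetric])
    also have "\<dots> \<le> 1"
      using q det_model_support_is_clique[OF H d] by (simp add: fractional_packings_def)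
    finally show ?thesis .
  qed
  then show ?thesis
    using classical_bound_leI[of H q 1] by simp
qed

theorem theorem29:
  fixes H :: "'v hypergraph" and p :: "'v \<Rightarrow> real"
  assumes "contextual_scenario H" and "p \<in> prob_models H"
  shows "ennreal (fractional_packing_number (non_orth_graph H) p) \<le> max_violation H p"
proof -
  have verts: "gverts (non_orth_graph H) = hverts H"
    by (simp add: non_orth_graph_def)
  have "finite (gverts (non_orth_graph H))"
    using assms(1) by (simp add: verts contextual_scenario_def)
  then obtain q where q: "q \<in> fractional_packings (non_orth_graph H)"
    and opt: "fractional_packing_number (non_orth_graph H) p = pairing H p q"
    using fractional_packing_number_attained[of "non_orth_graph H" p]
    unfolding pairing_def verts by metis
  have "ennreal (pairing H p q) \<le> violation H p q"
    using classical_bound_fractional_packing_le_1[OF assms(1) q] by (rule pairing_le_violation)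
  also have "\<dots> \<le> max_violation H p"
    using q by (intro violation_le_max_violation[OF assms])
      (simp add: fractional_packings_def nonneg_weights_def verts)
  finally show ?thesis
    by (simp add: opt)
qed

end
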